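(* The parity-constrained Hanoi graphs $P^0,P^1,P^2$ are planar, whereas $P^n$ is non-planar for every $n\ge3$.
   Context: Let $Q=\{0,1,2,3\}$ (pegs: $0,3$ neutral; $1$ reserved for even discs; $2$ reserved for odd discs). For a disc $d\in\{1,\dots,n\}$ let $p(d)=1$ if $d$ is even and $p(d)=2$ if $d$ is odd, and $Q^d=\{0,p(d),3\}$. The vertices of $P^n$ are words $s=s_n\cdots s_1\in Q^n$ ($s_d$ is the peg of disc $d$) with $s_d\in Q^d$ for all $d$. Two vertices are adjacent iff they differ in exactly one coordinate $d$, with values $i\ne j$ there, $i,j\in Q^d$, and $s_k\notin\{i,j\}$ for all $k<d$. $P^0$ is the graph with one vertex. *)

theory Defs
  imports "HOL-Analysis.Analysis" "Graph_Theory.Pair_Digraph"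
begin

section \<open>Parity-constrained Hanoi graphs\<close>

definition reserved_peg :: "nat \<Rightarrow> nat" where
  "reserved_peg d = (if even d then 1 else 2)"

definition allowed_pegs :: "nat \<Rightarrow> nat set" where
  "allowed_pegs d = {0, reserved_peg d, 3}"

text \<open>
  A word \<open>s\<^sub>n \<dots> s\<^sub>1\<close> is an extensional function on \<open>{1..n}\<close>, with \<open>s d\<close> the peg of disc \<open>d\<close>;
  in particular there is exactly one word for \<open>n = 0\<close>.
\<close>

definition hanoi_states :: "nat \<Rightarrow> (nat \<Rightarrow> nat) set" where
  "hanoi_states n = (\<Pi>\<^sub>E d\<in>{1..n}. allowed_pegs d)"

definition hanoi_move :: "nat \<Rightarrow> (nat \<Rightarrow> nat) \<Rightarrow> (nat \<Rightarrow> nat) \<Rightarrow> bool" where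
  "hanoi_move n s t \<longleftrightarrow>
    (\<exists>d\<in>{1..n}. s d \<noteq> t d \<and> (\<forall>k\<in>{1..n} - {d}. s k = t k) \<and>
       (\<forall>k\<in>{1..<d}. s k \<notin> {s d, t d}))"

text \<open>An undirected simple graph is represented by its symmetric loop-free digraph.\<close>

definition parity_hanoi :: "nat \<Rightarrow> (nat \<Rightarrow> nat) pair_pre_digraph" where
  "parity_hanoi n =
    \<lparr> pverts = hanoi_states n,
      parcs = {(s, t). s \<in> hanoi_states n \<and> t \<in> hanoi_states n \<and> hanoi_move n s t} \<rparr>"

lemma finite_hanoi_states: "finite (hanoi_states n)"
  unfolding hanoi_states_def by (intro finite_PiE) (auto simp: allowed_pegs_def)

lemma hanoi_move_sym:
  assumes "hanoi_move n s t"
  shows "hanoi_move n t s"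
proof -
  obtain d where d: "d \<in> {1..n}" "s d \<noteq> t d" "\<forall>k\<in>{1..n} - {d}. s k = t k"
    "\<forall>k\<in>{1..<d}. s k \<notin> {s d, t d}"
    using assms unfolding hanoi_move_def by blast
  have "t k \<notin> {t d, s d}" if "k \<in> {1..<d}" for k
  proof -
    have "k \<in> {1..n} - {d}" using that d(1) by auto
    then show ?thesis using d(3,4) that by (metis insert_commute)
  qed
  moreover have "t d \<noteq> s d" "\<forall>k\<in>{1..n} - {d}. t k = s k"
    using d(2,3) by auto
  ultimately show ?thesis unfolding hanoi_move_def using d(1) by blast
qed

lemma pair_graph_parity_hanoi: "pair_graph (parity_hanoi n)"
proof
  show "finite (pverts (parity_hanoi n))"
    by (simp add: parity_hanoi_def finite_hanoi_states)
  have "parcs (parity_hanoi n) \<subseteq> hanoi_states n \<times> hanoi_states n"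
    by (auto simp: parity_hanoi_def)
  then show "finite (parcs (parity_hanoi n))"
    by (rule finite_subset) (simp add: finite_hanoi_states)
  show "symmetric (with_proj (parity_hanoi n))"
    unfolding symmetric_def by (auto simp: parity_hanoi_def sym_def intro: hanoi_move_sym)
qed (auto simp: parity_hanoi_def hanoi_move_def)


section \<open>Planarity of undirected graphs\<close>

text \<open>
  A plane drawing maps the vertices to distinct points of the plane and every undirected edge
  \<open>{u, v}\<close> to a simple arc joining the points of \<open>u\<close> and \<open>v\<close>, such that an arc contains no
  vertex points besides its endpoints and two arcs meet at most in common endpoints.
  Curves are indexed by the unordered pair of ends, so that \<open>(u, v)\<close> and \<open>(v, u)\<close> share one arc.
\<close>

definition plane_drawing ::
    "'a pair_pre_digraph \<Rightarrow> ('a \<Rightarrow> complex) \<Rightarrow> ('a set \<Rightarrow> real \<Rightarrow> complex) \<Rightarrow> bool" where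
  "plane_drawing G pos curve \<longleftrightarrow>
     inj_on pos (pverts G) \<and>
     (\<forall>(u, v)\<in>parcs G.
        arc (curve {u, v}) \<and>
        {pathstart (curve {u, v}), pathfinish (curve {u, v})} = {pos u, pos v} \<and>
        path_image (curve {u, v}) \<inter> pos ` pverts G = {pos u, pos v}) \<and>
     (\<forall>(u, v)\<in>parcs G. \<forall>(x, y)\<in>parcs G. {u, v} \<noteq> {x, y} \<longrightarrow>
        path_image (curve {u, v}) \<inter> path_image (curve {x, y}) \<subseteq> pos ` ({u, v} \<inter> {x, y}))"

definition planar :: "'a pair_pre_digraph \<Rightarrow> bool" where
  "planar G \<longleftrightarrow> (\<exists>pos curve. plane_drawing G pos curve)"

end

(*
  Nonplanarity: a plane theta curve, three arcs with common ends a and b, cuts the plane into three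
  faces, each bounded by only two of the arcs, so a connected set off the curve cannot reach the
  interiors of all three.  In P^3 the words (written s3 s2 s1) with s3 = 0 contain the theta graph
    002-012-010,  002-032-030-010,  002-003-013-010,
  and the walk 033-233-232-212-213-210-310-312 avoids it and has a neighbour inside each path.
  Placing a new largest disc on peg 0 embeds P^n into P^(n+1), so nonplanarity propagates upwards
  and planarity downwards; P^2 has an explicit straight-line drawing.
*)

theory Submission
  imports Defs
begin

text \<open>Together the theta graph and the walk form a subdivision of K_{3,3} with sides {002,
  010, 213} and {012, 032, 013}. The contradiction is drawn directly from the Jordan curve theorem
  and the splitting of the inside of a closed curve by a crosscut. Two obstacles shape the argument.
  The splitting statement needs the third arc to run inside the loop of the other two; instead of
  deciding which of three arcs is the middle one, an inversion centred inside the loop moves an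
  outer third arc inside. Moreover, the arcs of a drawing are merely continuous, so there is no
  evident way to step from an arc sideways into a face. The connected set therefore stays off the
  curve and is only required to have, in its closure, a point of each arc other than the two
  ends.\<close>

section \<open>Theta curves\<close>

text \<open>On the Riemann sphere the inversion \<open>f\<close> swaps \<open>p\<close> and
  infinity. Concretely, the image of the outside together with 0 is bounded, because the outside
  keeps away from \<open>p\<close>; its frontier lies in the image of \<open>K\<close>; and interior
  points of a bounded set lie inside its frontier.\<close>

lemma inversion_outside_subset_inside:
  fixes K :: "complex set"
  assumes K: "compact K" and p: "p \<in> inside K" and x: "x \<in> outside K"
  shows "inverse (x - p) \<in> inside ((\<lambda>z. inverse (z - p)) ` K)"
proof -
  define f where "f = (\<lambda>z::complex. inverse (z - p))"
  define g where "g = (\<lambda>w::complex. inverse w + p)"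
  \<comment> \<open>0 is the image of infinity; with it \<open>U\<close> is a neighbourhood of 0, so
    0 is no frontier point.\<close>
  define U where "U = f ` outside K \<union> {0}"
  have closed: "closed K" using K by (rule compact_imp_closed)
  have gf: "g (f z) = z" if "z \<noteq> p" for z
    using that by (simp add: f_def g_def)
  \<comment> \<open>There is no exception at 0: \<open>inverse 0 = 0\<close> gives
    \<open>g 0 = p\<close> and \<open>f p = 0\<close>.\<close>
  have fg: "f (g w) = w" for w
    by (simp add: f_def g_def)
  have p_out: "p \<notin> outside K" and p_K: "p \<notin> K"
    using p inside_Int_outside[of K] inside_no_overlap[of K] by blast+
  obtain e where e: "e > 0" "ball p e \<subseteq> inside K"
    using p open_inside[OF closed] openE by blast
  have "norm (f z) \<le> inverse e" if "z \<in> outside K" for z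
  proof -
    have "z \<notin> ball p e"
      using that e(2) inside_Int_outside[of K] by blast
    then have "e \<le> norm (z - p)"
      by (simp add: dist_norm norm_minus_commute)
    then show ?thesis
      unfolding f_def norm_inverse using e(1) by (rule le_imp_inverse_le)
  qed
  then have "bounded U"
    using e(1) by (intro boundedI[of _ "inverse e"]) (auto simp: U_def)
  have cont_g: "continuous_on (- {0}) g"
    unfolding g_def by (intro continuous_intros) auto
  have open_pre: "open (- {0} \<inter> g -` T)" if "open T" for T
    using continuous_on_open_vimage[of "- {0}" g] cont_g that
    by (metis Int_commute open_Compl closed_singleton)
  have pre_out: "- {0} \<inter> g -` outside K \<subseteq> U"
  proof
    fix w assume w: "w \<in> - {0} \<inter> g -` outside K"
    then have "f (g w) \<in> f ` outside K" by blast
    then show "w \<in> U" by (simp add: fg U_def)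
  qed
  have zero: "0 \<in> interior U"
  proof -
    obtain B where B: "B > 0" "K \<subseteq> ball 0 B"
      by (metis K compact_imp_bounded bounded_subset_ballD)
    have far: "g w \<in> outside K" if "w \<noteq> 0" "norm w < inverse (B + norm p)" for w
    proof -
      have "B + norm p < norm (inverse w)"
        using that B(1) less_imp_inverse_less[of "norm w" "inverse (B + norm p)"]
        by (simp add: norm_inverse add_pos_nonneg)
      also have "\<dots> \<le> norm (g w) + norm p"
        unfolding g_def by (metis add_diff_cancel_right' norm_triangle_ineq4)
      finally have "B < norm (g w)" by simp
      then have "g w \<in> - ball 0 B" by simp
      then show ?thesis
        using outside_mono[OF B(2)] outside_convex[of "ball (0::complex) B"] by auto
    qed
    have "ball 0 (inverse (B + norm p)) \<subseteq> U"
    proof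
      fix w :: complex assume "w \<in> ball 0 (inverse (B + norm p))"
      then show "w \<in> U"
        using far[of w] pre_out by (cases "w = 0") (auto simp: U_def)
    qed
    then show ?thesis
      using B(1) by (intro interiorI[of "ball 0 (inverse (B + norm p))"]) (auto simp: add_pos_nonneg)
  qed
  have "frontier U \<subseteq> f ` K"
  proof
    fix w assume w: "w \<in> frontier U"
    show "w \<in> f ` K"
    proof (rule ccontr)
      assume "w \<notin> f ` K"
      then have gK: "g w \<notin> K" using fg by (metis image_eqI)
      have "w \<noteq> 0" using w zero by (auto simp: frontier_def)
      consider "g w \<in> outside K" | "g w \<in> inside K"
        using gK inside_Un_outside[of K] by blast
      then show False
      proof cases
        case 1
        then have "w \<in> interior U"
          using interior_maximal[OF pre_out open_pre] open_outside[OF closed] \<open>w \<noteq> 0\<close> by blast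
        then show False using w by (auto simp: frontier_def)
      next
        case 2
        \<comment> \<open>A point carried by \<open>g\<close> into the inside has an open
          neighbourhood missing \<open>U\<close>, so it is not even in the closure of
          \<open>U\<close>.\<close>
        let ?V = "- {0} \<inter> g -` inside K"
        have "?V \<inter> U = {}"
        proof (intro equals0I)
          fix v assume v: "v \<in> ?V \<inter> U"
          then obtain z where "z \<in> outside K" "v = f z" by (auto simp: U_def)
          then have "g v \<in> outside K" using gf p_out by metis
          then show False using v inside_Int_outside[of K] by blast
        qed
        moreover have "open ?V" using open_pre open_inside[OF closed] by blast
        ultimately have "?V \<inter> closure U = {}"
          using open_Int_closure_eq_empty by blast
        then show False using 2 \<open>w \<noteq> 0\<close> w by (auto simp: frontier_def)
      qed
    qed
  qed
  moreover have "x \<noteq> p" using x p_out by blast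
  then have fx: "f x \<noteq> 0" "g (f x) = x"
    using gf by (simp_all add: f_def)
  then have "f x \<in> interior U"
    using interior_maximal[OF pre_out open_pre] open_outside[OF closed] x by blast
  then have "f x \<in> inside (frontier U)"
    using interior_inside_frontier[OF \<open>bounded U\<close>] by blast
  \<comment> \<open>\<open>inside_mono\<close> enlarges the barrier from the frontier to the image
    of \<open>K\<close> only for points off that image.\<close>
  moreover have "f x \<notin> f ` K"
    using fx(2) gf p_K x outside_no_overlap[of K] by (metis disjoint_iff image_iff)
  ultimately show ?thesis
    using inside_mono f_def by blast
qed

definition theta_curve ::
    "complex \<Rightarrow> complex \<Rightarrow> (real \<Rightarrow> complex) \<Rightarrow> (real \<Rightarrow> complex) \<Rightarrow> (real \<Rightarrow> complex) \<Rightarrow> bool" where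
  "theta_curve a b c1 c2 c3 \<longleftrightarrow>
     (\<forall>c\<in>{c1, c2, c3}. arc c \<and> pathstart c = a \<and> pathfinish c = b) \<and>
     path_image c1 \<inter> path_image c2 = {a, b} \<and>
     path_image c1 \<inter> path_image c3 = {a, b} \<and>
     path_image c2 \<inter> path_image c3 = {a, b}"

text \<open>\<open>c1\<close> followed by the reverse of \<open>c2\<close> is a simple loop. Only
  this pair is treated; \<open>theta_curve_perm\<close> brings the other pairs into this
  position.\<close>

lemma theta_curve_Jordan:
  assumes "theta_curve a b c1 c2 c3"
  shows "open (inside (path_image c1 \<union> path_image c2))"
    and "open (outside (path_image c1 \<union> path_image c2))"
    and "inside (path_image c1 \<union> path_image c2) \<noteq> {}"
    and "frontier (inside (path_image c1 \<union> path_image c2)) = path_image c1 \<union> path_image c2"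
    and "compact (path_image c1 \<union> path_image c2)"
proof -
  have loop: "simple_path (c1 +++ reversepath c2)"
    "pathfinish (c1 +++ reversepath c2) = pathstart (c1 +++ reversepath c2)"
    and im: "path_image (c1 +++ reversepath c2) = path_image c1 \<union> path_image c2"
    using assms
    by (auto simp: theta_curve_def simple_path_join_loop_eq arc_reversepath path_image_join)
  show "open (inside (path_image c1 \<union> path_image c2))"
    "open (outside (path_image c1 \<union> path_image c2))"
    "inside (path_image c1 \<union> path_image c2) \<noteq> {}"
    "frontier (inside (path_image c1 \<union> path_image c2)) = path_image c1 \<union> path_image c2"
    using Jordan_inside_outside[OF loop] unfolding im by blast+
  show "compact (path_image c1 \<union> path_image c2)"
    using compact_simple_path_image[OF loop(1)] unfolding im .
qed

lemma theta_curve_perm: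
  assumes "theta_curve a b c1 c2 c3"
  shows "theta_curve a b c1 c3 c2" "theta_curve a b c2 c3 c1"
  using assms by (auto simp: theta_curve_def Int_commute)

lemma connected_subset_open_cover:
  assumes "connected S" "open A" "open B" "A \<inter> B = {}" "S \<subseteq> A \<union> B"
  shows "S \<subseteq> A \<or> S \<subseteq> B"
  using connectedD[OF assms(1-3)] assms(4,5) by blast

text \<open>Each face keeps one arc out of reach: from outside the loop it is \<open>c3\<close>, and
  from the face between \<open>c3\<close> and one of \<open>c1\<close>, \<open>c2\<close> it is the
  other of these two.\<close>

lemma no_tripod_nested_theta_curve:
  assumes theta: "theta_curve a b c1 c2 c3"
    and nested: "path_image c3 \<inter> inside (path_image c1 \<union> path_image c2) \<noteq> {}"
    and S: "connected S" "S \<inter> (path_image c1 \<union> path_image c2 \<union> path_image c3) = {}"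
    and touch: "\<And>c. c \<in> {c1, c2, c3} \<Longrightarrow> closure S \<inter> (path_image c - {a, b}) \<noteq> {}"
  shows False
proof -
  let ?C1 = "path_image c1" and ?C2 = "path_image c2" and ?C3 = "path_image c3"
  have th: "?C1 \<inter> ?C2 = {a, b}" "?C1 \<inter> ?C3 = {a, b}" "?C2 \<inter> ?C3 = {a, b}"
    using theta by (auto simp: theta_curve_def)
  have "a \<noteq> b"
    using theta arc_distinct_ends[of c1] by (auto simp: theta_curve_def)
  then obtain disj: "inside (?C1 \<union> ?C3) \<inter> inside (?C2 \<union> ?C3) = {}"
    and union: "inside (?C1 \<union> ?C3) \<union> inside (?C2 \<union> ?C3) \<union> (?C3 - {a, b}) = inside (?C1 \<union> ?C2)"
    using theta nested split_inside_simple_closed_curve[of c1 a b c2 c3]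
    by (auto simp: theta_curve_def arc_imp_simple_path)
  have sub1: "inside (?C1 \<union> ?C3) \<subseteq> inside (?C1 \<union> ?C2)"
    and sub2: "inside (?C2 \<union> ?C3) \<subseteq> inside (?C1 \<union> ?C2)"
    and sub3: "?C3 - {a, b} \<subseteq> inside (?C1 \<union> ?C2)"
    unfolding union[symmetric] by auto
  note J12 = theta_curve_Jordan[OF theta]
  note J13 = theta_curve_Jordan[OF theta_curve_perm(1)[OF theta]]
  note J23 = theta_curve_Jordan[OF theta_curve_perm(2)[OF theta]]
  \<comment> \<open>Both inner faces at once: \<open>C\<close> bounds the face together with
    \<open>c3\<close>, and \<open>c'\<close> is the remaining arc, which the closure of the face
    meets at most in \<open>a\<close> and \<open>b\<close>.\<close>
  have away: False if "S \<subseteq> inside (C \<union> ?C3)" "inside (C \<union> ?C3) \<subseteq> inside (?C1 \<union> ?C2)"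
    "frontier (inside (C \<union> ?C3)) = C \<union> ?C3" "c' \<in> {c1, c2}"
    "path_image c' \<inter> (C \<union> ?C3) \<subseteq> {a, b}" for C c'
  proof -
    have "closure S \<subseteq> inside (C \<union> ?C3) \<union> (C \<union> ?C3)"
      using closure_mono[OF that(1)] that(3) by (metis closure_Un_frontier)
    moreover have "inside (C \<union> ?C3) \<inter> path_image c' = {}"
      using that(2,4) inside_no_overlap[of "?C1 \<union> ?C2"] by (fastforce simp: disjoint_iff)
    moreover have "closure S \<inter> (path_image c' - {a, b}) \<noteq> {}"
      using that(4) by (intro touch) auto
    ultimately show False
      using that(5) by blast
  qed
  have "S \<subseteq> inside (?C1 \<union> ?C2) \<or> S \<subseteq> outside (?C1 \<union> ?C2)"
    using S(2) by (intro connected_subset_open_cover S(1) J12 inside_Int_outside) auto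
  then show False
  proof
    assume "S \<subseteq> outside (?C1 \<union> ?C2)"
    then have "inside (?C1 \<union> ?C2) \<inter> closure S = {}"
      using J12(1) inside_Int_outside[of "?C1 \<union> ?C2"] open_Int_closure_eq_empty by blast
    then show False
      using touch[of c3] sub3 by blast
  next
    assume "S \<subseteq> inside (?C1 \<union> ?C2)"
    then have "S \<subseteq> inside (?C1 \<union> ?C3) \<union> inside (?C2 \<union> ?C3)"
      using S(2) unfolding union[symmetric] by blast
    then have "S \<subseteq> inside (?C1 \<union> ?C3) \<or> S \<subseteq> inside (?C2 \<union> ?C3)"
      by (rule connected_subset_open_cover[OF S(1) J13(1) J23(1) disj])
    then show False
    proof
      assume S1: "S \<subseteq> inside (?C1 \<union> ?C3)"
      have "?C2 \<inter> (?C1 \<union> ?C3) \<subseteq> {a, b}"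
        using th(1,3) by blast
      then show False
        using away[OF S1 sub1 J13(4), of c2] by simp
    next
      assume S2: "S \<subseteq> inside (?C2 \<union> ?C3)"
      have "?C1 \<inter> (?C2 \<union> ?C3) \<subseteq> {a, b}"
        using th(1,2) by blast
      then show False
        using away[OF S2 sub2 J23(4), of c1] by simp
    qed
  qed
qed

text \<open>
  If the third arc lies outside the loop formed by the other two, inversion about a point
  inside that loop brings it inside.
\<close>

lemma no_tripod_theta_curve:
  assumes theta: "theta_curve a b c1 c2 c3"
    and S: "connected S" "S \<inter> (path_image c1 \<union> path_image c2 \<union> path_image c3) = {}"
    and touch: "\<And>c. c \<in> {c1, c2, c3} \<Longrightarrow> closure S \<inter> (path_image c - {a, b}) \<noteq> {}"
  shows False
proof (cases "path_image c3 \<inter> inside (path_image c1 \<union> path_image c2) = {}")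
  case False
  then show ?thesis using no_tripod_nested_theta_curve assms by blast
next
  case True
  let ?K = "path_image c1 \<union> path_image c2"
  note J = theta_curve_Jordan[OF theta]
  have c3_out: "path_image c3 - {a, b} \<subseteq> outside ?K"
  proof -
    have "(path_image c3 - {a, b}) \<inter> ?K = {}"
      using theta by (auto simp: theta_curve_def)
    then show ?thesis
      using True inside_Un_outside[of ?K] by blast
  qed
  have "S \<subseteq> inside ?K \<or> S \<subseteq> outside ?K"
    using S(2) by (intro connected_subset_open_cover S(1) J inside_Int_outside) auto
  \<comment> \<open>The outside is open and contains \<open>c3\<close> without its ends, so a set
    inside the loop has no limit point there.\<close>
  moreover have "\<not> S \<subseteq> inside ?K"
  proof
    assume "S \<subseteq> inside ?K"
    then have "outside ?K \<inter> closure S = {}"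
      using J(2) inside_Int_outside[of ?K] open_Int_closure_eq_empty by blast
    then show False using touch[of c3] c3_out by blast
  qed
  ultimately have S_out: "S \<subseteq> outside ?K" by blast
  obtain p where p: "p \<in> inside ?K" using J(3) by blast
  \<comment> \<open>The centre must avoid the closure of \<open>S\<close>, not just
    \<open>S\<close>: the points where \<open>S\<close> touches the arcs are limit points, and
    continuity of \<open>f\<close> on the closure transports them.\<close>
  have p_cl: "p \<notin> closure S"
    using S_out p J(1) inside_Int_outside[of ?K] open_Int_closure_eq_empty[of "inside ?K" S] by blast
  have p_c: "p \<notin> path_image c1" "p \<notin> path_image c2" "p \<notin> path_image c3"
    using p True inside_no_overlap[of ?K] by blast+
  define f where "f = (\<lambda>z::complex. inverse (z - p))"
  have inj: "inj f" by (auto simp: f_def inj_on_def)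
  have cont: "continuous_on T f" if "p \<notin> T" for T
    unfolding f_def using that by (intro continuous_intros) auto
  have arc: "arc (f \<circ> c)" if "arc c" "p \<notin> path_image c" for c
    using that simple_path_continuous_image[of c f] cont inj
    by (auto simp: arc_simple_path pathstart_compose pathfinish_compose inj_eq inj_on_subset)
  have theta': "theta_curve (f a) (f b) (f \<circ> c1) (f \<circ> c2) (f \<circ> c3)"
    using theta p_c
    by (auto simp: theta_curve_def arc pathstart_compose pathfinish_compose path_image_compose
        image_Int[OF inj, symmetric])
  \<comment> \<open>A point of the third arc off its ends lies outside the loop; its image certifies
    that the inverted configuration is nested.\<close>
  obtain x where x: "x \<in> closure S" "x \<in> path_image c3 - {a, b}"
    using touch[of c3] by blast
  have "f x \<in> inside (f ` ?K)"
    unfolding f_def using inversion_outside_subset_inside[OF J(5) p] x(2) c3_out by blast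
  then have "path_image (f \<circ> c3) \<inter> inside (path_image (f \<circ> c1) \<union> path_image (f \<circ> c2)) \<noteq> {}"
    using x(2) by (auto simp: path_image_compose image_Un[symmetric])
  moreover have "connected (f ` S)"
    using S(1) p_cl closure_subset[of S] by (intro connected_continuous_image cont) auto
  moreover have "f ` S \<inter> (path_image (f \<circ> c1) \<union> path_image (f \<circ> c2) \<union> path_image (f \<circ> c3)) = {}"
    using S(2) by (auto simp: path_image_compose inj_eq[OF inj])
  moreover have "closure (f ` S) \<inter> (path_image c' - {f a, f b}) \<noteq> {}"
    if c': "c' \<in> {f \<circ> c1, f \<circ> c2, f \<circ> c3}" for c'
  proof -
    obtain c where c: "c \<in> {c1, c2, c3}" "c' = f \<circ> c" using c' by auto
    obtain y where y: "y \<in> closure S" "y \<in> path_image c - {a, b}"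
      using touch[OF c(1)] by blast
    have "f ` closure S \<subseteq> closure (f ` S)"
      by (rule image_closure_subset[OF cont[OF p_cl] closed_closure closure_subset])
    then have "f y \<in> closure (f ` S) \<inter> (path_image (f \<circ> c) - {f a, f b})"
      using y by (simp add: path_image_compose inj_eq[OF inj] image_subset_iff)
    then show ?thesis unfolding c(2) by (metis empty_iff)
  qed
  ultimately show False
    by (intro no_tripod_nested_theta_curve[OF theta', of "f ` S"]) auto
qed

section \<open>Drawings and walks\<close>

fun walk_edges :: "'a list \<Rightarrow> 'a set set" where
  "walk_edges (x # y # xs) = insert {x, y} (walk_edges (y # xs))"
| "walk_edges _ = {}"

lemma walk_edges_subset: "e \<in> walk_edges p \<Longrightarrow> e \<subseteq> set p"
  by (induction p rule: walk_edges.induct) auto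

lemma walk_edges_arcs:
  assumes "successively (\<lambda>u v. (u, v) \<in> A) p" "e \<in> walk_edges p"
  obtains u v where "(u, v) \<in> A" "e = {u, v}"
  using assms by (induction p rule: walk_edges.induct) auto

text \<open>Removing the final point leaves a connected set that still has this point as a limit;
  this is how a set can touch the theta curve without meeting it.\<close>

lemma arc_half_open:
  fixes g :: "real \<Rightarrow> 'a::real_normed_vector"
  assumes "arc g"
  shows "connected (path_image g - {pathfinish g})"
    and "pathfinish g \<in> closure (path_image g - {pathfinish g})"
proof -
  have inj: "inj_on g {0..1}" and cont: "continuous_on {0..1} g"
    using assms by (auto simp: arc_def path_def)
  have eq: "path_image g - {pathfinish g} = g ` {0..<1}"
  proof -
    have "g ` ({0..1} - {1}) = g ` {0..1} - g ` {1}"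
      using inj by (intro inj_on_image_set_diff) auto
    moreover have "{0..1} - {1::real} = {0..<1}" by auto
    ultimately show ?thesis by (simp add: path_image_def pathfinish_def)
  qed
  show "connected (path_image g - {pathfinish g})"
    unfolding eq by (intro connected_continuous_image continuous_on_subset[OF cont]) auto
  have "g ` closure {0..<1} \<subseteq> closure (g ` {0..<1})"
    using cont by (intro image_closure_subset closure_subset) auto
  then show "pathfinish g \<in> closure (path_image g - {pathfinish g})"
    unfolding eq by (auto simp: pathfinish_def)
qed

section \<open>Walks of a drawn graph as arcs and connected sets of the plane\<close>

locale drawn_graph =
  fixes G :: "'a pair_pre_digraph" and pos :: "'a \<Rightarrow> complex" and curve :: "'a set \<Rightarrow> real \<Rightarrow> complex"
  assumes arcs_verts: "parcs G \<subseteq> pverts G \<times> pverts G"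
    and drawing: "plane_drawing G pos curve"
begin

abbreviation walk :: "'a list \<Rightarrow> bool" where
  "walk \<equiv> successively (\<lambda>u v. (u, v) \<in> parcs G)"

definition curves :: "'a set set \<Rightarrow> complex set" where
  "curves E = (\<Union>e\<in>E. path_image (curve e))"

lemma inj_pos: "inj_on pos (pverts G)"
  using drawing by (simp add: plane_drawing_def)

lemma edge_ends:
  assumes "(u, v) \<in> parcs G"
  shows "pos u \<in> path_image (curve {u, v})" "pos v \<in> path_image (curve {u, v})"
  using drawing assms by (auto simp: plane_drawing_def)

lemma pos_in_curve:
  assumes "(u, v) \<in> parcs G" "x \<in> pverts G" "pos x \<in> path_image (curve {u, v})"
  shows "x \<in> {u, v}"
proof -
  have "pos x \<in> {pos u, pos v}"
    using drawing assms by (fastforce simp: plane_drawing_def)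
  then show ?thesis
    using inj_pos assms(1,2) arcs_verts by (auto dest: inj_onD)
qed

lemma curve_Int_curve:
  assumes "(u, v) \<in> parcs G" "(x, y) \<in> parcs G" "{u, v} \<noteq> {x, y}"
  shows "path_image (curve {u, v}) \<inter> path_image (curve {x, y}) \<subseteq> pos ` ({u, v} \<inter> {x, y})"
  using drawing assms unfolding plane_drawing_def by blast

text \<open>The curve is indexed by an unordered pair, so its direction is unknown; it is reversed
  when it runs from \<open>v\<close> to \<open>u\<close>.\<close>

lemma oriented_edge_arc:
  assumes "(u, v) \<in> parcs G"
  obtains g where "arc g" "pathstart g = pos u" "pathfinish g = pos v"
    "path_image g = path_image (curve {u, v})"
proof -
  have *: "arc (curve {u, v})" "{pathstart (curve {u, v}), pathfinish (curve {u, v})} = {pos u, pos v}"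
    using drawing assms by (auto simp: plane_drawing_def)
  then consider "pathstart (curve {u, v}) = pos u" "pathfinish (curve {u, v}) = pos v"
    | "pathstart (curve {u, v}) = pos v" "pathfinish (curve {u, v}) = pos u"
    by (auto simp: doubleton_eq_iff)
  then show ?thesis
  proof cases
    case 1
    then show ?thesis using * that by blast
  next
    case 2
    then show ?thesis
      using * that[of "reversepath (curve {u, v})"] by (simp add: arc_reversepath)
  qed
qed

text \<open>A common point lies on one edge curve of each walk; these edges differ, so it is the
  point of a vertex they share.\<close>

lemma curves_Int_curves:
  assumes "walk p" "walk q" "walk_edges p \<inter> walk_edges q = {}"
  shows "curves (walk_edges p) \<inter> curves (walk_edges q) \<subseteq> pos ` (set p \<inter> set q)"
proof
  fix z assume "z \<in> curves (walk_edges p) \<inter> curves (walk_edges q)"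
  then obtain e f where e: "e \<in> walk_edges p" "z \<in> path_image (curve e)"
    and f: "f \<in> walk_edges q" "z \<in> path_image (curve f)"
    by (auto simp: curves_def)
  moreover have "e \<noteq> f" using e f assms(3) by blast
  moreover obtain u v where "(u, v) \<in> parcs G" "e = {u, v}"
    using walk_edges_arcs[OF assms(1) e(1)] .
  moreover obtain x y where "(x, y) \<in> parcs G" "f = {x, y}"
    using walk_edges_arcs[OF assms(2) f(1)] .
  ultimately have "z \<in> pos ` (e \<inter> f)"
    using curve_Int_curve[of u v x y] by auto
  then show "z \<in> pos ` (set p \<inter> set q)"
    using walk_edges_subset[OF e(1)] walk_edges_subset[OF f(1)] by blast
qed

lemma walk_arc:
  assumes "walk p" "distinct p" "length p \<ge> 2"
  obtains g where "arc g" "pathstart g = pos (hd p)" "pathfinish g = pos (last p)"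
    "path_image g = curves (walk_edges p)"
  using assms
proof (induction p arbitrary: thesis rule: walk_edges.induct)
  case (1 x y xs)
  obtain h where h: "arc h" "pathstart h = pos x" "pathfinish h = pos y"
    "path_image h = path_image (curve {x, y})"
    using oriented_edge_arc[of x y] "1.prems" by auto
  show ?case
  proof (cases xs)
    case Nil
    then show ?thesis using h "1.prems"(1)[of h] by (simp add: curves_def)
  next
    case (Cons z zs)
    obtain g where g: "arc g" "pathstart g = pos y" "pathfinish g = pos (last (y # xs))"
      "path_image g = curves (walk_edges (y # xs))"
      using "1.IH" "1.prems" Cons by auto
    \<comment> \<open>The walk repeats no vertex, so \<open>x\<close> lies on no later edge and the
      first edge meets the rest only at \<open>y\<close>.\<close>
    have "{x, y} \<notin> walk_edges (y # xs)"
      using walk_edges_subset[of "{x, y}" "y # xs"] "1.prems"(3) by auto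
    then have "path_image h \<inter> path_image g \<subseteq> pos ` (set [x, y] \<inter> set (y # xs))"
      using curves_Int_curves[of "[x, y]" "y # xs"] "1.prems"(2) h(4) g(4) by (simp add: curves_def)
    also have "\<dots> \<subseteq> {pathstart g}"
      using "1.prems"(3) g(2) by auto
    finally have "arc (h +++ g)" using h g by (intro arc_join) auto
    moreover have "path_image (h +++ g) = curves (walk_edges (x # y # xs))"
      using h g by (simp add: path_image_join curves_def)
    ultimately show ?thesis
      using "1.prems"(1)[of "h +++ g"] h g Cons by simp
  qed
qed auto

lemma walk_vertex:
  assumes "walk p" "length p \<ge> 2" "x \<in> set p"
  shows "pos x \<in> curves (walk_edges p)" "x \<in> pverts G"
proof -
  have "pos x \<in> curves (walk_edges p) \<and> x \<in> pverts G"
    using assms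
  proof (induction p rule: walk_edges.induct)
    case (1 y z xs)
    then have yz: "(y, z) \<in> parcs G" by simp
    show ?case
    proof (cases "x \<in> {y, z}")
      case True
      then show ?thesis using edge_ends[OF yz] arcs_verts yz by (auto simp: curves_def)
    next
      case False
      then have "length (z # xs) \<ge> 2" using "1.prems"(3) by (cases xs) auto
      then show ?thesis using 1 False by (auto simp: curves_def)
    qed
  qed auto
  then show "pos x \<in> curves (walk_edges p)" "x \<in> pverts G" by auto
qed

text \<open>Consecutive edge curves share a vertex point. The vertex points are added so that a walk
  with a single vertex is drawn as that point and not as the empty set.\<close>

lemma connected_walk:
  assumes "walk p"
  shows "connected (pos ` set p \<union> curves (walk_edges p))"
  using assms
proof (induction p rule: walk_edges.induct)
  case (1 x y xs)
  then have xy: "(x, y) \<in> parcs G" by simp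
  obtain h where "arc h" "path_image h = path_image (curve {x, y})"
    using oriented_edge_arc[OF xy] by metis
  then have "connected (path_image (curve {x, y}))"
    using connected_arc_image by metis
  moreover have "connected (pos ` set (y # xs) \<union> curves (walk_edges (y # xs)))"
    using 1 by simp
  moreover have "pos y \<in> path_image (curve {x, y}) \<inter> (pos ` set (y # xs) \<union> curves (walk_edges (y # xs)))"
    using edge_ends[OF xy] by simp
  ultimately have "connected (path_image (curve {x, y}) \<union> (pos ` set (y # xs) \<union> curves (walk_edges (y # xs))))"
    by - (rule connected_Un, assumption, assumption, blast)
  also have "path_image (curve {x, y}) \<union> (pos ` set (y # xs) \<union> curves (walk_edges (y # xs)))
      = pos ` set (x # y # xs) \<union> curves (walk_edges (x # y # xs))"
    using edge_ends[OF xy] by (auto simp: curves_def)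
  finally show ?case .
qed (auto simp: curves_def)

text \<open>The paths become a theta curve, and the walk with one attaching edge per path becomes a
  connected set touching all three arcs. Edge disjointness is asked for besides the vertex condition
  because two paths could both be the single edge from \<open>a\<close> to \<open>b\<close>.\<close>

lemma no_tripod_on_theta_graph:
  assumes walks: "walk p1" "walk p2" "walk p3" "distinct p1" "distinct p2" "distinct p3"
    and ends: "hd p1 = a" "hd p2 = a" "hd p3 = a" "last p1 = b" "last p2 = b" "last p3 = b"
    and "length p1 \<ge> 2" "length p2 \<ge> 2" "length p3 \<ge> 2"
    and disj: "set p1 \<inter> set p2 = {a, b}" "set p1 \<inter> set p3 = {a, b}" "set p2 \<inter> set p3 = {a, b}"
    and edge_disj: "walk_edges p1 \<inter> walk_edges p2 = {}" "walk_edges p1 \<inter> walk_edges p3 = {}"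
      "walk_edges p2 \<inter> walk_edges p3 = {}"
    and w: "walk w" "set w \<subseteq> pverts G" "set w \<inter> (set p1 \<union> set p2 \<union> set p3) = {}"
    and attach: "\<And>p. p \<in> {p1, p2, p3} \<Longrightarrow> \<exists>u\<in>set w. \<exists>v\<in>set p - {a, b}. (u, v) \<in> parcs G"
  shows False
proof -
  obtain c1 where c1: "arc c1" "pathstart c1 = pos a" "pathfinish c1 = pos b"
    "path_image c1 = curves (walk_edges p1)"
    using walk_arc[of p1] assms by metis
  obtain c2 where c2: "arc c2" "pathstart c2 = pos a" "pathfinish c2 = pos b"
    "path_image c2 = curves (walk_edges p2)"
    using walk_arc[of p2] assms by metis
  obtain c3 where c3: "arc c3" "pathstart c3 = pos a" "pathfinish c3 = pos b"
    "path_image c3 = curves (walk_edges p3)"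
    using walk_arc[of p3] assms by metis
  note c = c1 c2 c3
  have ends_in: "{pos a, pos b} \<subseteq> path_image c1" "{pos a, pos b} \<subseteq> path_image c2"
    "{pos a, pos b} \<subseteq> path_image c3"
    using c by (metis empty_subsetI insert_subset pathfinish_in_path_image pathstart_in_path_image)+
  have theta: "theta_curve (pos a) (pos b) c1 c2 c3"
    using c ends_in curves_Int_curves[of p1 p2] curves_Int_curves[of p1 p3] curves_Int_curves[of p2 p3]
      walks disj edge_disj
    unfolding theta_curve_def by auto
  obtain u v where uv: "\<And>p. p \<in> {p1, p2, p3} \<Longrightarrow>
      u p \<in> set w \<and> v p \<in> set p - {a, b} \<and> (u p, v p) \<in> parcs G"
    using attach by metis
  \<comment> \<open>The foot \<open>pos (v p)\<close> lies on the theta curve and is cut off; it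
    remains a limit point of the leg.\<close>
  define leg where "leg p = path_image (curve {u p, v p}) - {pos (v p)}" for p
  define W where "W = pos ` set w \<union> curves (walk_edges w)"
  define S where "S = W \<union> leg p1 \<union> leg p2 \<union> leg p3"
  have leg: "connected (leg p)" "pos (v p) \<in> closure (leg p)" "pos (u p) \<in> W \<inter> leg p"
    if p: "p \<in> {p1, p2, p3}" for p
  proof -
    have e: "(u p, v p) \<in> parcs G" using uv[OF p] by blast
    obtain g where "arc g" "pathfinish g = pos (v p)" "path_image g = path_image (curve {u p, v p})"
      using oriented_edge_arc[OF e] by metis
    then show "connected (leg p)" "pos (v p) \<in> closure (leg p)"
      using arc_half_open[of g] by (simp_all add: leg_def)
    have "u p \<noteq> v p" using uv[OF p] w(3) p by auto
    then have "pos (u p) \<noteq> pos (v p)"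
      using inj_pos e arcs_verts by (auto dest: inj_onD)
    then show "pos (u p) \<in> W \<inter> leg p"
      using uv[OF p] edge_ends[OF e] by (auto simp: leg_def W_def)
  qed
  have "connected W" unfolding W_def using w(1) by (rule connected_walk)
  have extend: "connected (T \<union> leg p)" if "connected T" "W \<subseteq> T" "p \<in> {p1, p2, p3}" for T p
    using leg(1,3)[OF that(3)] that(1,2) by - (rule connected_Un, assumption+, blast)
  have "connected S"
    unfolding S_def using \<open>connected W\<close> by (intro extend) auto
  \<comment> \<open>Vertex points of \<open>w\<close> fall under the rule that a curve contains no
    foreign vertex, its edges and the legs under the rule on pairs of edges. A leg could meet the
    path at most in the foot, which was removed.\<close>
  have avoid: "S \<inter> curves (walk_edges q) = {}" if q: "q \<in> {p1, p2, p3}" for q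
  proof -
    have "walk q" and wq: "set w \<inter> set q = {}" using q walks w(3) by auto
    have "pos ` set w \<inter> curves (walk_edges q) = {}"
    proof (rule ccontr)
      assume "\<not> ?thesis"
      then obtain x e where x: "x \<in> set w" and e: "e \<in> walk_edges q" "pos x \<in> path_image (curve e)"
        by (auto simp: curves_def)
      then have "x \<in> e"
        using w(2) pos_in_curve[of _ _ x] walk_edges_arcs[OF \<open>walk q\<close> e(1)] by (metis subsetD)
      then show False using x wq walk_edges_subset[OF e(1)] by blast
    qed
    moreover have "walk_edges w \<inter> walk_edges q = {}"
    proof (rule ccontr)
      assume "\<not> ?thesis"
      then obtain e where e: "e \<in> walk_edges w" "e \<in> walk_edges q" by blast
      then have "e = {}" using walk_edges_subset[of e] wq by blast
      then show False using walk_edges_arcs[OF w(1) e(1)] by (metis insert_not_empty)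
    qed
    then have "curves (walk_edges w) \<inter> curves (walk_edges q) = {}"
      using curves_Int_curves[OF w(1) \<open>walk q\<close>] wq by blast
    moreover have "leg p \<inter> curves (walk_edges q) = {}" if p: "p \<in> {p1, p2, p3}" for p
    proof -
      have u: "u p \<notin> set q" using uv[OF p] wq by blast
      then have "{u p, v p} \<notin> walk_edges q"
        using walk_edges_subset[of "{u p, v p}" q] by blast
      then have "path_image (curve {u p, v p}) \<inter> curves (walk_edges q) \<subseteq> pos ` ({u p, v p} \<inter> set q)"
        using curves_Int_curves[of "[u p, v p]" q] uv[OF p] \<open>walk q\<close> by (simp add: curves_def)
      then show ?thesis using u by (auto simp: leg_def)
    qed
    then have "leg p1 \<inter> curves (walk_edges q) = {}" "leg p2 \<inter> curves (walk_edges q) = {}"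
      "leg p3 \<inter> curves (walk_edges q) = {}" by simp_all
    ultimately show ?thesis unfolding S_def W_def by blast
  qed
  have touch: "pos (v p) \<in> closure S \<inter> (curves (walk_edges p) - {pos a, pos b})"
    if p: "p \<in> {p1, p2, p3}" for p
  proof -
    have "leg p \<subseteq> S" using p by (auto simp: S_def)
    then have "pos (v p) \<in> closure S" using leg(2)[OF p] closure_mono by blast
    moreover have "v p \<in> set p" "v p \<noteq> a" "v p \<noteq> b" using uv[OF p] by auto
    moreover have "length p \<ge> 2" "walk p" "a \<in> set p" "b \<in> set p" using p assms by auto
    have in_curves: "pos x \<in> curves (walk_edges p)" "x \<in> pverts G" if "x \<in> set p" for x
      using that \<open>walk p\<close> \<open>length p \<ge> 2\<close> walk_vertex by blast+
    have "pos (v p) \<noteq> pos a" "pos (v p) \<noteq> pos b"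
      using inj_pos in_curves(2) \<open>v p \<in> set p\<close> \<open>v p \<noteq> a\<close> \<open>v p \<noteq> b\<close> \<open>a \<in> set p\<close> \<open>b \<in> set p\<close>
      by (metis inj_onD)+
    ultimately show ?thesis using in_curves(1) by blast
  qed
  show False
  proof (rule no_tripod_theta_curve[OF theta \<open>connected S\<close>])
    show "S \<inter> (path_image c1 \<union> path_image c2 \<union> path_image c3) = {}"
      using avoid c by (simp add: Int_Un_distrib)
    show "closure S \<inter> (path_image c - {pos a, pos b}) \<noteq> {}" if "c \<in> {c1, c2, c3}" for c
      using that touch[of p1] touch[of p2] touch[of p3] c1(4) c2(4) c3(4) by auto
  qed
qed

end

section \<open>Carrying drawings over to subgraphs\<close>

lemma plane_drawingI:
  assumes "inj_on pos (pverts G)"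
    and "\<And>u v. (u, v) \<in> parcs G \<Longrightarrow> arc (curve {u, v})"
    and "\<And>u v. (u, v) \<in> parcs G \<Longrightarrow>
      {pathstart (curve {u, v}), pathfinish (curve {u, v})} = {pos u, pos v}"
    and "\<And>u v. (u, v) \<in> parcs G \<Longrightarrow> path_image (curve {u, v}) \<inter> pos ` pverts G = {pos u, pos v}"
    and "\<And>u v x y. (u, v) \<in> parcs G \<Longrightarrow> (x, y) \<in> parcs G \<Longrightarrow> {u, v} \<noteq> {x, y} \<Longrightarrow>
      path_image (curve {u, v}) \<inter> path_image (curve {x, y}) \<subseteq> pos ` ({u, v} \<inter> {x, y})"
  shows "plane_drawing G pos curve"
  unfolding plane_drawing_def by (intro conjI ballI case_prodI2 impI assms) simp_all

text \<open>The drawing is pulled back: an edge of \<open>H\<close> uses the curve of its image.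
  Injectivity keeps different edges on different curves and makes every common end of two image
  edges come from a common end in \<open>H\<close>.\<close>

lemma planar_embedding:
  assumes "planar G" and arcs: "parcs H \<subseteq> pverts H \<times> pverts H"
    and inj: "inj_on \<phi> (pverts H)" and verts: "\<phi> ` pverts H \<subseteq> pverts G"
    and hom: "\<And>u v. (u, v) \<in> parcs H \<Longrightarrow> (\<phi> u, \<phi> v) \<in> parcs G"
  shows "planar H"
proof -
  obtain pos curve where D: "plane_drawing G pos curve"
    using assms(1) by (auto simp: planar_def)
  have inj': "inj_on (pos \<circ> \<phi>) (pverts H)"
    using D inj verts by (auto simp: plane_drawing_def intro: comp_inj_on inj_on_subset)
  have edge: "arc (curve (\<phi> ` {u, v}))"
    "{pathstart (curve (\<phi> ` {u, v})), pathfinish (curve (\<phi> ` {u, v}))} = {pos (\<phi> u), pos (\<phi> v)}"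
    "path_image (curve (\<phi> ` {u, v})) \<inter> pos ` pverts G = {pos (\<phi> u), pos (\<phi> v)}"
    if "(u, v) \<in> parcs H" for u v
    using D hom[OF that] unfolding plane_drawing_def image_insert image_empty by blast+
  have vertex: "path_image (curve (\<phi> ` {u, v})) \<inter> (pos \<circ> \<phi>) ` pverts H = {(pos \<circ> \<phi>) u, (pos \<circ> \<phi>) v}"
    if "(u, v) \<in> parcs H" for u v
  proof -
    have "{pos (\<phi> u), pos (\<phi> v)} \<subseteq> (pos \<circ> \<phi>) ` pverts H" using arcs that by auto
    moreover have "(pos \<circ> \<phi>) ` pverts H \<subseteq> pos ` pverts G" using verts by auto
    ultimately show ?thesis using edge(3)[OF that] by auto
  qed
  have cross: "path_image (curve (\<phi> ` {u, v})) \<inter> path_image (curve (\<phi> ` {x, y}))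
      \<subseteq> (pos \<circ> \<phi>) ` ({u, v} \<inter> {x, y})"
    if e: "(u, v) \<in> parcs H" "(x, y) \<in> parcs H" "{u, v} \<noteq> {x, y}" for u v x y
  proof -
    have sub: "{u, v} \<subseteq> pverts H" "{x, y} \<subseteq> pverts H" using arcs e by auto
    then have "\<phi> ` {u, v} \<noteq> \<phi> ` {x, y}"
      using e(3) inj_on_image_eq_iff[OF inj] by metis
    then have "path_image (curve (\<phi> ` {u, v})) \<inter> path_image (curve (\<phi> ` {x, y}))
      \<subseteq> pos ` (\<phi> ` {u, v} \<inter> \<phi> ` {x, y})"
      using D hom[OF e(1)] hom[OF e(2)] unfolding plane_drawing_def image_insert image_empty by blast
    also have "\<phi> ` {u, v} \<inter> \<phi> ` {x, y} = \<phi> ` ({u, v} \<inter> {x, y})"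
      using inj_on_image_Int[OF inj sub] by simp
    finally show ?thesis by (simp only: image_comp)
  qed
  have "plane_drawing H (pos \<circ> \<phi>) (\<lambda>e. curve (\<phi> ` e))"
  proof (rule plane_drawingI[OF inj' edge(1) _ vertex cross])
    show "{pathstart (curve (\<phi> ` {u, v})), pathfinish (curve (\<phi> ` {u, v}))} = {(pos \<circ> \<phi>) u, (pos \<circ> \<phi>) v}"
      if "(u, v) \<in> parcs H" for u v
      using edge(2)[OF that] by simp
  qed
  then show ?thesis by (auto simp: planar_def)
qed

section \<open>Straight-line drawings\<close>

text \<open>Twice the signed area of the triangle \<open>a\<close>, \<open>b\<close>,
  \<open>c\<close>; its sign tells on which side of the line through \<open>a\<close> and
  \<open>b\<close> the point \<open>c\<close> lies.\<close>

definition orient :: "complex \<Rightarrow> complex \<Rightarrow> complex \<Rightarrow> real" where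
  "orient a b c = (Re b - Re a) * (Im c - Im a) - (Im b - Im a) * (Re c - Re a)"

lemma orient_segment:
  "orient a b ((1 - t) *\<^sub>R c + t *\<^sub>R d) = (1 - t) * orient a b c + t * orient a b d"
  by (simp add: orient_def algebra_simps)

lemma orient_on_segment: "z \<in> closed_segment a b \<Longrightarrow> orient a b z = 0"
  unfolding in_segment by (auto simp: orient_segment) (simp add: orient_def)

text \<open>\<open>c\<close> and \<open>d\<close> lie strictly on the same side of the line through
  \<open>a\<close> and \<open>b\<close>; since \<open>orient a b\<close> is affine along a segment,
  it has no zero between them.\<close>

lemma closed_segments_disjoint:
  assumes "0 < orient a b c * orient a b d"
  shows "closed_segment a b \<inter> closed_segment c d = {}"
proof (intro equals0I)
  fix z assume z: "z \<in> closed_segment a b \<inter> closed_segment c d"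
  then obtain t where t: "0 \<le> t" "t \<le> 1" "z = (1 - t) *\<^sub>R c + t *\<^sub>R d"
    by (auto simp: in_segment)
  have 0: "(1 - t) * orient a b c + t * orient a b d = 0"
    using orient_on_segment[of z a b] z unfolding t(3) orient_segment by blast
  consider "orient a b c > 0" "orient a b d > 0" | "orient a b c < 0" "orient a b d < 0"
    using assms by (auto simp: zero_less_mult_iff)
  then show False
  proof cases
    case 1
    then show False using 0 t convex_bound_lt[of "- orient a b c" 0 "- orient a b d" "1 - t" t] by simp
  next
    case 2
    then show False using 0 t convex_bound_lt[of "orient a b c" 0 "orient a b d" "1 - t" t] by simp
  qed
qed

lemma closed_segments_meet_at_endpoint:
  assumes "orient a b d \<noteq> 0"
  shows "closed_segment a b \<inter> closed_segment a d \<subseteq> {a}"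
proof
  fix z assume z: "z \<in> closed_segment a b \<inter> closed_segment a d"
  then obtain t where t: "z = (1 - t) *\<^sub>R a + t *\<^sub>R d"
    by (auto simp: in_segment)
  have "(1 - t) * orient a b a + t * orient a b d = 0"
    using orient_on_segment[of z a b] z unfolding t orient_segment by blast
  then have "t = 0" using assms by (simp add: orient_def)
  then show "z \<in> {a}" using t by simp
qed

text \<open>A certificate that simplification can evaluate at concrete points: the same edge, or a
  common end (in any of four positions) with the far ends not collinear with it, or one edge
  strictly on one side of the line through the other.\<close>

definition segments_ok :: "('a \<Rightarrow> complex) \<Rightarrow> 'a \<Rightarrow> 'a \<Rightarrow> 'a \<Rightarrow> 'a \<Rightarrow> bool" where
  "segments_ok pos u v x y \<longleftrightarrow>
     u = x \<and> (v = y \<or> orient (pos u) (pos v) (pos y) \<noteq> 0) \<or>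
     u = y \<and> (v = x \<or> orient (pos u) (pos v) (pos x) \<noteq> 0) \<or>
     v = x \<and> orient (pos v) (pos u) (pos y) \<noteq> 0 \<or>
     v = y \<and> orient (pos v) (pos u) (pos x) \<noteq> 0 \<or>
     0 < orient (pos u) (pos v) (pos x) * orient (pos u) (pos v) (pos y) \<or>
     0 < orient (pos x) (pos y) (pos u) * orient (pos x) (pos y) (pos v)"

lemma segments_ok_Int:
  assumes "segments_ok pos u v x y" "{u, v} \<noteq> {x, y}"
  shows "closed_segment (pos u) (pos v) \<inter> closed_segment (pos x) (pos y) \<subseteq> pos ` ({u, v} \<inter> {x, y})"
proof -
  have ne: "\<not> (u = x \<and> v = y)" "\<not> (u = y \<and> v = x)" using assms(2) by auto
  consider "u = x" "orient (pos u) (pos v) (pos y) \<noteq> 0"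
    | "u = y" "orient (pos u) (pos v) (pos x) \<noteq> 0"
    | "v = x" "orient (pos v) (pos u) (pos y) \<noteq> 0"
    | "v = y" "orient (pos v) (pos u) (pos x) \<noteq> 0"
    | "0 < orient (pos u) (pos v) (pos x) * orient (pos u) (pos v) (pos y)"
    | "0 < orient (pos x) (pos y) (pos u) * orient (pos x) (pos y) (pos v)"
    using assms(1) ne unfolding segments_ok_def by argo
  then show ?thesis
  proof cases
    case 1
    then show ?thesis using closed_segments_meet_at_endpoint by blast
  next
    case 2
    then show ?thesis
      using closed_segments_meet_at_endpoint[of "pos u" "pos v" "pos x"]
      by (auto simp: closed_segment_commute[of "pos x"])
  next
    case 3
    then show ?thesis
      using closed_segments_meet_at_endpoint[of "pos v" "pos u" "pos y"]
      by (auto simp: closed_segment_commute[of "pos u"])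
  next
    case 4
    then show ?thesis
      using closed_segments_meet_at_endpoint[of "pos v" "pos u" "pos x"]
      by (auto simp: closed_segment_commute[of _ "pos y"])
  next
    case 5
    then show ?thesis using closed_segments_disjoint by blast
  next
    case 6
    then show ?thesis using closed_segments_disjoint by blast
  qed
qed

text \<open>
  As no vertex is isolated, the condition that an edge avoids all vertices other than its ends
  follows from the condition on pairs of edges.
\<close>

lemma planar_straight_line:
  fixes pos :: "'a \<Rightarrow> complex"
  assumes inj: "inj_on pos (pverts G)"
    and E: "E \<subseteq> pverts G \<times> pverts G" "parcs G \<subseteq> E \<union> E\<inverse>" "\<And>u. (u, u) \<notin> E"
    and isolated: "pverts G \<subseteq> Field E"
    and ok: "\<And>u v x y. (u, v) \<in> E \<Longrightarrow> (x, y) \<in> E \<Longrightarrow> segments_ok pos u v x y"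
  shows "planar G"
proof -
  \<comment> \<open>\<open>linepath\<close> needs a direction but an unordered pair has none, so one
    of the two orders is chosen; either serves.\<close>
  define curve where
    "curve e = (case SOME (u, v). e = {u, v} of (u, v) \<Rightarrow> linepath (pos u) (pos v))" for e
  have curve: "curve {u, v} = linepath (pos u) (pos v) \<or> curve {u, v} = linepath (pos v) (pos u)" for u v
  proof -
    have "case SOME (x, y). {u, v} = {x, y} of (x, y) \<Rightarrow> {u, v} = {x, y}"
      by (rule someI[of _ "(u, v)"]) simp
    then show ?thesis
      unfolding curve_def by (auto simp: doubleton_eq_iff split: prod.splits)
  qed
  have image: "path_image (curve {u, v}) = closed_segment (pos u) (pos v)" for u v
    using curve[of u v] by (auto simp: closed_segment_commute)
  have meet: "path_image (curve {u, v}) \<inter> path_image (curve {x, y}) \<subseteq> pos ` ({u, v} \<inter> {x, y})"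
    if uv: "(u, v) \<in> E \<union> E\<inverse>" and xy: "(x, y) \<in> E \<union> E\<inverse>" and ne: "{u, v} \<noteq> {x, y}" for u v x y
  proof -
    obtain u' v' where u: "(u', v') \<in> E" "{u, v} = {u', v'}" using uv by auto
    obtain x' y' where x: "(x', y') \<in> E" "{x, y} = {x', y'}" using xy by auto
    show ?thesis
      using segments_ok_Int[OF ok[OF u(1) x(1)]] ne unfolding u(2) x(2) image by blast
  qed
  have vertex: "path_image (curve {u, v}) \<inter> pos ` pverts G = {pos u, pos v}"
    if e: "(u, v) \<in> parcs G" for u v
  proof
    have uv: "{u, v} \<subseteq> pverts G" using e E by auto
    then show "{pos u, pos v} \<subseteq> path_image (curve {u, v}) \<inter> pos ` pverts G"
      by (auto simp: image)
    show "path_image (curve {u, v}) \<inter> pos ` pverts G \<subseteq> {pos u, pos v}"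
    proof
      fix z assume z: "z \<in> path_image (curve {u, v}) \<inter> pos ` pverts G"
      then obtain x where x: "x \<in> pverts G" "z = pos x" by blast
      obtain y where y: "(x, y) \<in> E \<union> E\<inverse>" using isolated x(1) by (auto simp: Field_def)
      show "z \<in> {pos u, pos v}"
      proof (cases "{u, v} = {x, y}")
        case True
        then show ?thesis using x by auto
      next
        case False
        moreover have "z \<in> path_image (curve {x, y})" using x by (simp add: image)
        ultimately show ?thesis using meet[of u v x y] e E(2) y z by blast
      qed
    qed
  qed
  have arcs: "arc (curve {u, v})" "{pathstart (curve {u, v}), pathfinish (curve {u, v})} = {pos u, pos v}"
    if "(u, v) \<in> parcs G" for u v
  proof -
    have "u \<noteq> v" "u \<in> pverts G" "v \<in> pverts G" using that E by auto
    then have "pos u \<noteq> pos v" using inj by (auto dest: inj_onD)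
    then show "arc (curve {u, v})"
      "{pathstart (curve {u, v}), pathfinish (curve {u, v})} = {pos u, pos v}"
      using curve[of u v] by auto
  qed
  have "plane_drawing G pos curve"
    using E(2) by (intro plane_drawingI inj arcs vertex meet) auto
  then show ?thesis by (auto simp: planar_def)
qed

section \<open>Parity-constrained Hanoi graphs\<close>

lemma parcs_parity_hanoi_subset:
  "parcs (parity_hanoi n) \<subseteq> pverts (parity_hanoi n) \<times> pverts (parity_hanoi n)"
  by (auto simp: parity_hanoi_def)

lemma hanoi_state_largest_disc:
  assumes "s \<in> hanoi_states n"
  shows "s(Suc n := 0) \<in> hanoi_states (Suc n)"
  using assms by (auto simp: hanoi_states_def PiE_iff allowed_pegs_def extensional_def)

text \<open>Only discs smaller than the moving one can obstruct a move, and the new disc is larger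
  than all others.\<close>

lemma hanoi_move_largest_disc:
  assumes "hanoi_move n s t"
  shows "hanoi_move (Suc n) (s(Suc n := 0)) (t(Suc n := 0))"
proof -
  obtain d where "d \<in> {1..n}" "s d \<noteq> t d" "\<forall>k\<in>{1..n} - {d}. s k = t k"
    "\<forall>k\<in>{1..<d}. s k \<notin> {s d, t d}"
    using assms unfolding hanoi_move_def by blast
  then show ?thesis
    unfolding hanoi_move_def by (intro bexI[of _ d]) auto
qed

lemma planar_parity_hanoi_Suc:
  assumes "planar (parity_hanoi (Suc n))"
  shows "planar (parity_hanoi n)"
proof (rule planar_embedding[OF assms parcs_parity_hanoi_subset])
  show "inj_on (\<lambda>s. s(Suc n := 0)) (pverts (parity_hanoi n))"
  proof (rule inj_onI)
    fix s t :: "nat \<Rightarrow> nat"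
    assume st: "s \<in> pverts (parity_hanoi n)" "t \<in> pverts (parity_hanoi n)"
      and eq: "s(Suc n := 0) = t(Suc n := 0)"
    \<comment> \<open>Words are extensional, so both take the value \<open>undefined\<close> at
      \<open>Suc n\<close>, and overwriting it loses nothing.\<close>
    have "s (Suc n) = t (Suc n)"
      using st by (auto simp: parity_hanoi_def hanoi_states_def PiE_iff extensional_def)
    then show "s = t" using eq by (metis fun_upd_triv fun_upd_upd)
  qed
qed (auto simp: parity_hanoi_def hanoi_state_largest_disc hanoi_move_largest_disc)

text \<open>Tuples list the largest disc first, like the written words. The simplification rules are
  withdrawn below, so that words stay opaque and are compared through their tuples.\<close>

fun word2 :: "nat \<times> nat \<Rightarrow> nat \<Rightarrow> nat" where
  "word2 (y, x) = (\<lambda>d\<in>{1..2}. if d = 1 then x else y)"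

fun word3 :: "nat \<times> nat \<times> nat \<Rightarrow> nat \<Rightarrow> nat" where
  "word3 (z, y, x) = (\<lambda>d\<in>{1..3}. if d = 1 then x else if d = 2 then y else z)"

lemma interval_1_2: "{1..2} = {1, 2::nat}" and interval_1_3: "{1..3} = {1, 2, 3::nat}"
  by auto

lemma word2_apply: "word2 (y, x) 1 = x" "word2 (y, x) 2 = y" "word2 u \<in> extensional {1..2}"
  by (cases u; simp)+

lemma word3_apply: "word3 (z, y, x) 1 = x" "word3 (z, y, x) 2 = y" "word3 (z, y, x) 3 = z"
  "word3 u \<in> extensional {1..3}"
  by (cases u; simp)+

declare word2.simps [simp del] word3.simps [simp del]

lemma inj_word2: "inj word2"
  by (intro injI) (metis word2_apply(1,2) prod.exhaust)

lemma inj_word3: "inj word3"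
  by (intro injI) (metis word3_apply(1-3) prod.exhaust)

lemma word2_in_hanoi_states:
  "word2 (y, x) \<in> hanoi_states 2 \<longleftrightarrow> y \<in> {0, 1, 3} \<and> x \<in> {0, 2, 3}"
proof -
  have "word2 (y, x) \<in> hanoi_states 2 \<longleftrightarrow> (\<forall>d\<in>{1, 2}. word2 (y, x) d \<in> allowed_pegs d)"
    by (simp only: hanoi_states_def PiE_iff word2_apply(3) interval_1_2[symmetric] simp_thms)
  also have "\<dots> \<longleftrightarrow> x \<in> allowed_pegs 1 \<and> y \<in> allowed_pegs 2"
    by (simp only: ball_simps word2_apply simp_thms)
  finally show ?thesis by (simp add: allowed_pegs_def reserved_peg_def conj_commute)
qed

lemma word3_in_hanoi_states:
  "word3 (z, y, x) \<in> hanoi_states 3 \<longleftrightarrow> z \<in> {0, 2, 3} \<and> y \<in> {0, 1, 3} \<and> x \<in> {0, 2, 3}"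
proof -
  have "word3 (z, y, x) \<in> hanoi_states 3 \<longleftrightarrow> (\<forall>d\<in>{1, 2, 3}. word3 (z, y, x) d \<in> allowed_pegs d)"
    by (simp only: hanoi_states_def PiE_iff word3_apply(4) interval_1_3[symmetric] simp_thms)
  also have "\<dots> \<longleftrightarrow> x \<in> allowed_pegs 1 \<and> y \<in> allowed_pegs 2 \<and> z \<in> allowed_pegs 3"
    by (simp only: ball_simps word3_apply simp_thms)
  finally show ?thesis by (simp add: allowed_pegs_def reserved_peg_def conj_ac)
qed

lemma hanoi_states_2: "hanoi_states 2 = word2 ` ({0, 1, 3} \<times> {0, 2, 3})"
proof
  show "hanoi_states 2 \<subseteq> word2 ` ({0, 1, 3} \<times> {0, 2, 3})"
  proof
    fix s assume s: "s \<in> hanoi_states 2"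
    have "s = word2 (s 2, s 1)"
    proof
      fix d
      show "s d = word2 (s 2, s 1) d"
      proof (cases "d \<in> {1..2}")
        case True
        then show ?thesis unfolding interval_1_2 using word2_apply by auto
      next
        case False
        then show ?thesis
          using s word2_apply(3) by (simp add: hanoi_states_def PiE_iff extensional_def)
      qed
    qed
    then show "s \<in> word2 ` ({0, 1, 3} \<times> {0, 2, 3})"
      using s word2_in_hanoi_states[of "s 2" "s 1"] by (intro image_eqI[of _ _ "(s 2, s 1)"]) auto
  qed
  show "word2 ` ({0, 1, 3} \<times> {0, 2, 3}) \<subseteq> hanoi_states 2"
    using word2_in_hanoi_states by blast
qed

lemma hanoi_move_2:
  "hanoi_move 2 (word2 (y, x)) (word2 (y', x')) \<longleftrightarrow>
    x \<noteq> x' \<and> y = y' \<or> x = x' \<and> y \<noteq> y' \<and> x \<notin> {y, y'}"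
proof -
  have "{1..<1} = ({} :: nat set)" "{1..<2} = {1::nat}" "{1, 2} - {1} = {2::nat}" "{1, 2} - {2} = {1::nat}"
    by auto
  note sets = this
  show ?thesis
    unfolding hanoi_move_def interval_1_2 bex_simps ball_simps sets word2_apply by blast
qed

lemma hanoi_move_3:
  "hanoi_move 3 (word3 (z, y, x)) (word3 (z', y', x')) \<longleftrightarrow>
    x \<noteq> x' \<and> y = y' \<and> z = z' \<or> x = x' \<and> y \<noteq> y' \<and> z = z' \<and> x \<notin> {y, y'} \<or>
    x = x' \<and> y = y' \<and> z \<noteq> z' \<and> x \<notin> {z, z'} \<and> y \<notin> {z, z'}"
proof -
  have "{1..<1} = ({} :: nat set)" "{1..<2} = {1::nat}" "{1..<3} = {1, 2::nat}"
    "{1, 2, 3} - {1} = {2, 3::nat}" "{1, 2, 3} - {2} = {1, 3::nat}" "{1, 2, 3} - {3} = {1, 2::nat}"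
    by auto
  note sets = this
  show ?thesis
    unfolding hanoi_move_def interval_1_3 bex_simps ball_simps sets word3_apply by blast
qed

text \<open>With disc 1 on peg 2, disc 2 moves freely, which gives a central triangle 02, 12, 32.
  Each corner carries, pointing outwards, a triangle of moves of disc 1; the remaining edges 03-13
  and 10-30 pass below and to the right. The final \<open>else\<close> serves 33.\<close>

definition point2 :: "nat \<times> nat \<Rightarrow> complex" where
  "point2 u = (if u = (0, 0) then Complex (-2) (-1) else if u = (0, 2) then Complex 0 0
     else if u = (0, 3) then Complex 0 (-2) else if u = (1, 0) then Complex 6 1
     else if u = (1, 2) then Complex 4 0 else if u = (1, 3) then Complex 4 (-2)
     else if u = (3, 0) then Complex 4 5 else if u = (3, 2) then Complex 2 2
     else Complex 2 5)"

text \<open>One orientation per edge: nine moves of disc 1, then five of disc 2. The pairwise check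
  thus runs over 14 pairs instead of 28 arcs.\<close>

definition edges2 :: "((nat \<times> nat) \<times> nat \<times> nat) set" where
  "edges2 = {((0,0),(0,2)), ((0,0),(0,3)), ((0,2),(0,3)), ((1,0),(1,2)), ((1,0),(1,3)), ((1,2),(1,3)),
    ((3,0),(3,2)), ((3,0),(3,3)), ((3,2),(3,3)), ((0,2),(1,2)), ((0,3),(1,3)), ((0,2),(3,2)),
    ((1,2),(3,2)), ((1,0),(3,0))}"

lemma segments_ok_edges2:
  "\<forall>e\<in>edges2. \<forall>f\<in>edges2. segments_ok point2 (fst e) (snd e) (fst f) (snd f)"
proof -
  \<comment> \<open>\<open>One_nat_def\<close> turns peg 1 into \<open>Suc 0\<close>, so the
    coordinates are recorded in that form.\<close>
  have point2_simps: "point2 (0, 0) = Complex (-2) (-1)" "point2 (0, 2) = Complex 0 0"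
    "point2 (0, 3) = Complex 0 (-2)" "point2 (Suc 0, 0) = Complex 6 1" "point2 (Suc 0, 2) = Complex 4 0"
    "point2 (Suc 0, 3) = Complex 4 (-2)" "point2 (3, 0) = Complex 4 5" "point2 (3, 2) = Complex 2 2"
    "point2 (3, 3) = Complex 2 5"
    by (simp_all add: point2_def)
  show ?thesis
    unfolding edges2_def segments_ok_def One_nat_def by (simp add: orient_def point2_simps)
qed

lemma planar_parity_hanoi_2: "planar (parity_hanoi 2)"
proof (rule planar_straight_line)
  let ?pos = "\<lambda>s. point2 (s 2, s 1)" and ?E = "map_prod word2 word2 ` edges2"
  have pos: "?pos (word2 u) = point2 u" for u
    by (cases u) (simp only: word2_apply)
  have verts: "pverts (parity_hanoi 2) = word2 ` ({0, 1, 3} \<times> {0, 2, 3})"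
    by (simp add: parity_hanoi_def hanoi_states_2)
  have "inj_on point2 ({0, 1, 3} \<times> {0, 2, 3})"
    by (simp add: inj_on_def point2_def)
  then show "inj_on ?pos (pverts (parity_hanoi 2))"
    unfolding verts by (intro inj_on_imageI) (simp only: comp_def pos)
  show "?E \<subseteq> pverts (parity_hanoi 2) \<times> pverts (parity_hanoi 2)"
    unfolding verts by (auto simp: edges2_def)
  show "parcs (parity_hanoi 2) \<subseteq> ?E \<union> ?E\<inverse>"
  proof
    fix a assume "a \<in> parcs (parity_hanoi 2)"
    then obtain y x y' x' where a: "a = (word2 (y, x), word2 (y', x'))"
      "y \<in> {0, 1, 3}" "x \<in> {0, 2, 3}" "y' \<in> {0, 1, 3}" "x' \<in> {0, 2, 3}"
      "hanoi_move 2 (word2 (y, x)) (word2 (y', x'))"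
      by (auto simp: parity_hanoi_def hanoi_states_2)
    \<comment> \<open>The right-hand side of \<open>hanoi_move_2\<close>, checked for all 81 pairs
      of words.\<close>
    have table: "\<forall>y\<in>{0, 1, 3}. \<forall>x\<in>{0, 2, 3}. \<forall>y'\<in>{0, 1, 3}. \<forall>x'\<in>{0, 2, 3}.
        x \<noteq> x' \<and> y = y' \<or> x = x' \<and> y \<noteq> y' \<and> x \<notin> {y, y'} \<longrightarrow>
        ((y, x), (y', x')) \<in> edges2 \<union> edges2\<inverse>"
      by (simp add: edges2_def)
    have "((y, x), (y', x')) \<in> edges2 \<union> edges2\<inverse>"
      by (rule table[rule_format, OF a(2-5) a(6)[unfolded hanoi_move_2]])
    then show "a \<in> ?E \<union> ?E\<inverse>"
      using map_prod_imageI[of _ _ edges2 word2 word2] unfolding a(1) by blast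
  qed
  show "(s, s) \<notin> ?E" for s
  proof
    assume "(s, s) \<in> ?E"
    then obtain u v where uv: "(u, v) \<in> edges2" "word2 u = word2 v" by auto
    have "\<forall>e\<in>edges2. fst e \<noteq> snd e" by (simp add: edges2_def)
    from bspec[OF this uv(1)] have "u \<noteq> v" by simp
    then show False using uv(2) inj_eq[OF inj_word2] by simp
  qed
  have "{0, 1, 3} \<times> {0, 2, 3} \<subseteq> Field edges2"
    by (auto simp: edges2_def)
  moreover have "Field ?E = word2 ` Field edges2"
    by (simp add: Field_def Domain_fst Range_snd image_image image_Un)
  ultimately show "pverts (parity_hanoi 2) \<subseteq> Field ?E"
    unfolding verts by (simp only: image_mono)
  show "segments_ok ?pos s t s' t'" if "(s, t) \<in> ?E" "(s', t') \<in> ?E" for s t s' t'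
  proof -
    obtain u v x y where uv: "(u, v) \<in> edges2" and xy: "(x, y) \<in> edges2"
      and words: "s = word2 u" "t = word2 v" "s' = word2 x" "t' = word2 y"
      using \<open>(s, t) \<in> ?E\<close> \<open>(s', t') \<in> ?E\<close> by auto
    have "segments_ok point2 u v x y"
      using segments_ok_edges2[rule_format, OF uv xy] by (simp only: fst_conv snd_conv)
    then show ?thesis
      by (simp only: words segments_ok_def pos inj_eq[OF inj_word2])
  qed
qed

lemma not_planar_parity_hanoi_3: "\<not> planar (parity_hanoi 3)"
proof
  assume "planar (parity_hanoi 3)"
  then obtain pos curve where "plane_drawing (parity_hanoi 3) pos curve"
    by (auto simp: planar_def)
  then interpret drawn_graph "parity_hanoi 3" pos curve
    by unfold_locales (rule parcs_parity_hanoi_subset)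
  have verts: "word3 (z, y, x) \<in> pverts (parity_hanoi 3) \<longleftrightarrow>
      z \<in> {0, 2, 3} \<and> y \<in> {0, 1, 3} \<and> x \<in> {0, 2, 3}" for z y x
    by (simp add: parity_hanoi_def word3_in_hanoi_states)
  have arcs: "(word3 (z, y, x), word3 (z', y', x')) \<in> parcs (parity_hanoi 3) \<longleftrightarrow>
      word3 (z, y, x) \<in> pverts (parity_hanoi 3) \<and> word3 (z', y', x') \<in> pverts (parity_hanoi 3) \<and>
      (x \<noteq> x' \<and> y = y' \<and> z = z' \<or> x = x' \<and> y \<noteq> y' \<and> z = z' \<and> x \<notin> {y, y'} \<or>
      x = x' \<and> y = y' \<and> z \<noteq> z' \<and> x \<notin> {z, z'} \<and> y \<notin> {z, z'})" for z y x z' y' x'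
    by (simp add: parity_hanoi_def hanoi_move_3)
  \<comment> \<open>Disc 3 can leave peg 0 only from 012, 013 and 033. The first two are inner
    vertices of \<open>?p1\<close> and \<open>?p3\<close>; 033 lies off the theta graph, starts
    \<open>?w\<close> and reaches \<open>?p2\<close> through 032. The move 210-310 links the layers
    with disc 3 on pegs 2 and 3.\<close>
  let ?p1 = "map word3 [(0,0,2), (0,1,2), (0,1,0)]"
    and ?p2 = "map word3 [(0,0,2), (0,3,2), (0,3,0), (0,1,0)]"
    and ?p3 = "map word3 [(0,0,2), (0,0,3), (0,1,3), (0,1,0)]"
    and ?w = "map word3 [(0,3,3), (2,3,3), (2,3,2), (2,1,2), (2,1,3), (2,1,0), (3,1,0), (3,1,2)]"
  note simps = verts arcs inj_eq[OF inj_word3] doubleton_eq_iff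
  have attach: "\<exists>u\<in>set ?w. \<exists>v\<in>set p - {word3 (0,0,2), word3 (0,1,0)}. (u, v) \<in> parcs (parity_hanoi 3)"
    if p: "p \<in> {?p1, ?p2, ?p3}" for p
  proof -
    consider "p = ?p1" | "p = ?p2" | "p = ?p3" using p by blast
    then show ?thesis
    proof cases
      case 1
      then show ?thesis
        by (intro bexI[of _ "word3 (3,1,2)"] bexI[of _ "word3 (0,1,2)"]) (simp_all add: simps)
    next
      case 2
      then show ?thesis
        by (intro bexI[of _ "word3 (0,3,3)"] bexI[of _ "word3 (0,3,2)"]) (simp_all add: simps)
    next
      case 3
      then show ?thesis
        by (intro bexI[of _ "word3 (2,1,3)"] bexI[of _ "word3 (0,1,3)"]) (simp_all add: simps)
    qed
  qed
  show False
    by (rule no_tripod_on_theta_graph[OF _ _ _ _ _ _ _ _ _ _ _ _ _ _ _ _ _ _ _ _ _ _ _ _ attach])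
      (simp_all add: simps)
qed

theorem theorem6p8:
  shows "planar (parity_hanoi 0) \<and> planar (parity_hanoi 1) \<and> planar (parity_hanoi 2) \<and>
    (\<forall>n\<ge>3. \<not> planar (parity_hanoi n))"
proof (intro conjI allI impI)
  show "planar (parity_hanoi 2)" by (rule planar_parity_hanoi_2)
  then show "planar (parity_hanoi 1)"
    using planar_parity_hanoi_Suc[of 1] by (simp add: numeral_2_eq_2)
  then show "planar (parity_hanoi 0)"
    using planar_parity_hanoi_Suc[of 0] by simp
  show "\<not> planar (parity_hanoi n)" if "n \<ge> 3" for n
    using that
  proof (induction n rule: dec_induct)
    case base
    show ?case by (rule not_planar_parity_hanoi_3)
  next
    case (step m)
    then show ?case using planar_parity_hanoi_Suc by blast
  qed
qed

end
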